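(* Suppose that the neighbor graph $\mathbb{G}$ is strongly connected and $b_i>0$ for all $i\in\mathcal{V}$. Then $x_a^\ast=\mathbf{0}_N$ and $x_c^\ast=\mathbf{1}_N$ are locally exponentially stable equilibria, and $x_d^\ast=\frac12\mathbf{1}_N$ is an unstable equilibrium, of the system $x(k+1)=F(x(k))$.
   Context: There are $N\ge 2$ agents, $\mathcal{V}=\{1,\dots,N\}$. $\mathbb{G}=(\mathcal{V},\mathcal{E})$ is a directed graph without self-loops, $\mathcal{N}_i=\{j\in\mathcal{V}:(j,i)\in\mathcal{E}\}$ is the set of neighbors of agent $i$ (so $i\notin\mathcal{N}_i$). The weight matrix $W=(w_{ij})_{N\times N}$ is real with $w_{ii}\ge 0$ for all $i$ and $w_{ij}>0$ whenever $(j,i)\in\mathcal{E}$. $\mathbb{G}$ is strongly connected if there is a directed path from every node to every other node. Each agent $i$ has a real bias parameter $b_i$. Put $d_i=\sum_{j\in\mathcal{N}_i}w_{ij}$ and, for $x=(x_1,\dots,x_N)^\top$, $s_i=\sum_{j\in\mathcal{N}_i}w_{ij}x_j$ and $$f_i(x)=\frac{w_{ii}x_i+x_i^{b_i}s_i}{w_{ii}+x_i^{b_i}s_i+(1-x_i)^{b_i}(d_i-s_i)},\qquad F(x)=[f_1(x),\dots,f_N(x)]^\top.$$ The opinion dynamics is $x(k+1)=F(x(k))$, $k=0,1,2,\dots$, with $x_i(0)\in[0,1]$ for all $i$; the state space is $[0,1]^N$. $\mathbf{0}_N$ and $\mathbf{1}_N$ are the $N$-dimensional all-zero and all-one vectors.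 An equilibrium is a point $x^\ast$ with $F(x^\ast)=x^\ast$; local exponential stability and instability are in the usual (Lyapunov) sense for discrete-time systems on this state space. *)

theory Defs
  imports "HOL-Analysis.Analysis" "Graph_Theory.Graph_Theory"
begin

section \<open>Stability for discrete-time systems\<close>

text \<open>
  The system \<open>x (k + 1) = F (x k)\<close> on a state space \<open>X\<close>: the trajectory starting in
  \<open>x0 \<in> X\<close> is \<open>k \<mapsto> (F ^^ k) x0\<close>, and only initial states in \<open>X\<close> are considered.
\<close>

definition equilibrium :: "('a \<Rightarrow> 'a) \<Rightarrow> 'a set \<Rightarrow> 'a \<Rightarrow> bool" where
  "equilibrium F X p \<longleftrightarrow> p \<in> X \<and> F p = p"

definition lyapunov_stable :: "('a::metric_space \<Rightarrow> 'a) \<Rightarrow> 'a set \<Rightarrow> 'a \<Rightarrow> bool" where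
  "lyapunov_stable F X p \<longleftrightarrow>
     (\<forall>\<epsilon>>0. \<exists>\<delta>>0. \<forall>x0\<in>X. dist x0 p < \<delta> \<longrightarrow> (\<forall>k. dist ((F ^^ k) x0) p < \<epsilon>))"

definition locally_exp_stable_equilibrium ::
    "('a::metric_space \<Rightarrow> 'a) \<Rightarrow> 'a set \<Rightarrow> 'a \<Rightarrow> bool" where
  "locally_exp_stable_equilibrium F X p \<longleftrightarrow>
     equilibrium F X p \<and>
     (\<exists>r>0. \<exists>C>0. \<exists>q. 0 < q \<and> q < 1 \<and>
        (\<forall>x0\<in>X. dist x0 p < r \<longrightarrow> (\<forall>k. dist ((F ^^ k) x0) p \<le> C * q ^ k * dist x0 p)))"

definition unstable_equilibrium :: "('a::metric_space \<Rightarrow> 'a) \<Rightarrow> 'a set \<Rightarrow> 'a \<Rightarrow> bool" where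
  "unstable_equilibrium F X p \<longleftrightarrow> equilibrium F X p \<and> \<not> lyapunov_stable F X p"


section \<open>Opinion dynamics with biased assimilation\<close>

text \<open>The agents are the elements of a finite type \<open>'n\<close>; an arc \<open>(j, i)\<close> lets \<open>j\<close> influence \<open>i\<close>.\<close>

definition neighbors :: "'n pair_pre_digraph \<Rightarrow> 'n \<Rightarrow> 'n set" where
  "neighbors G i = {j. (j, i) \<in> parcs G}"

definition nbr_weight :: "'n pair_pre_digraph \<Rightarrow> real^'n^'n \<Rightarrow> 'n::finite \<Rightarrow> real" where
  "nbr_weight G W i = (\<Sum>j\<in>neighbors G i. W $ i $ j)"

definition nbr_opinion :: "'n pair_pre_digraph \<Rightarrow> real^'n^'n \<Rightarrow> real^'n \<Rightarrow> 'n::finite \<Rightarrow> real" where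
  "nbr_opinion G W x i = (\<Sum>j\<in>neighbors G i. W $ i $ j * x $ j)"

text \<open>
  For positive bias parameters, the convention \<open>0 powr a = 0\<close> is the usual one.  If every agent
  has a neighbor, the quotient is \<open>0 / 0\<close>, hence 0, exactly at the states of the cube where
  \<open>W $ i $ i = 0\<close> and either \<open>x $ i = 0\<close> while all neighbors of \<open>i\<close> have opinion 1, or
  \<open>x $ i = 1\<close> while all of them have opinion 0.  No such state lies near one of the constant
  states 0, 1/2 and 1.
\<close>

definition opinion_map ::
    "'n pair_pre_digraph \<Rightarrow> real^'n^'n \<Rightarrow> real^'n \<Rightarrow> real^'n \<Rightarrow> real^'n::finite" where
  "opinion_map G W b x =
     (\<chi> i. let s = nbr_opinion G W x i; d = nbr_weight G W i in
        (W $ i $ i * x $ i + x $ i powr b $ i * s) /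
        (W $ i $ i + x $ i powr b $ i * s + (1 - x $ i) powr b $ i * (d - s)))"

abbreviation opinion_space :: "(real^'n::finite) set" where
  "opinion_space \<equiv> cbox (vec 0) (vec 1)"

lemma mem_opinion_space: "x \<in> opinion_space \<longleftrightarrow> (\<forall>i. 0 \<le> x $ i \<and> x $ i \<le> 1)"
  by (simp add: mem_box_cart)

lemma opinion_map_in_opinion_space:
  assumes diag: "\<And>i. W $ i $ i \<ge> 0"
    and arcs: "\<And>i j. (j, i) \<in> parcs G \<Longrightarrow> W $ i $ j > 0"
    and x: "x \<in> opinion_space"
  shows "opinion_map G W b x \<in> opinion_space"
proof -
  have bounds: "0 \<le> x $ i" "x $ i \<le> 1" for i
    using x unfolding mem_opinion_space by blast+
  have "0 \<le> opinion_map G W b x $ i \<and> opinion_map G W b x $ i \<le> 1" for i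
  proof -
    define s where "s = nbr_opinion G W x i"
    define d where "d = nbr_weight G W i"
    define p where "p = W $ i $ i * x $ i + x $ i powr b $ i * s"
    define r where "r = W $ i $ i + x $ i powr b $ i * s + (1 - x $ i) powr b $ i * (d - s)"
    have "0 \<le> s"
      unfolding s_def nbr_opinion_def neighbors_def
      using arcs bounds by (intro sum_nonneg mult_nonneg_nonneg) (auto simp: less_imp_le)
    moreover have "s \<le> d"
      unfolding s_def d_def nbr_opinion_def nbr_weight_def neighbors_def
      using arcs bounds by (intro sum_mono mult_left_le) (auto simp: less_imp_le)
    moreover have "W $ i $ i * x $ i \<le> W $ i $ i"
      using diag bounds by (simp add: mult_left_le)
    ultimately have "0 \<le> p" "p \<le> r"
      using diag bounds by (simp_all add: p_def r_def add_mono add_increasing2)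
    hence "0 \<le> p / r" "p / r \<le> 1"
      by (auto simp: divide_le_eq_1)
    thus ?thesis
      by (simp add: opinion_map_def Let_def p_def r_def s_def d_def)
  qed
  thus ?thesis
    unfolding mem_opinion_space by blast
qed

end

theory Submission
  imports Defs
begin

text \<open>
  Each agent's update rule, seen as a function of the own opinion \<open>x\<close> and the weighted neighbor
  opinion \<open>s\<close>, averages 1 and 0 with weights proportional to \<open>w * x + x powr \<beta> * s\<close> and
  \<open>w * (1 - x) + (1 - x) powr \<beta> * (d - s)\<close>.  Three properties of this scalar rule decide everything.

  When all opinions are at most \<open>M \<le> r\<close>, the neighbors enter the first weight damped by the factor
  \<open>r powr \<beta>\<close>, while the total weight stays near \<open>w + d\<close>.  So the new opinion is at most \<open>M\<close> times
  about \<open>w / (w + d)\<close>, which is less than 1 as soon as \<open>d > 0\<close>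
  (\<open>biased_update_contracts_near_0\<close>).  Hence the map contracts the maximum norm near the zero
  state.  Strong connectivity enters here: it gives every agent a neighbor and thus \<open>d > 0\<close>.

  Exchanging the two ends of the opinion scale exchanges the two weights
  (\<open>biased_update_reflect\<close>), which transfers the contraction from the zero state to the state 1.

  At the state 1/2 the bias works the other way.  If all opinions are at least \<open>m0 > 1/2\<close>, then the
  weight \<open>x powr \<beta>\<close> of agreement exceeds the weight \<open>(1 - x) powr \<beta>\<close> of disagreement by a fixed
  margin, and every step raises the lowest opinion by a fixed amount as long as it is below 3/4
  (\<open>biased_update_gains_above_half\<close>).  A trajectory that starts just above 1/2 therefore
  leaves the ball of radius 1/4.  This monotonicity argument replaces an eigenvalue of modulus
  greater than 1, which a proof by linearization would have to exhibit.
\<close>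

section \<open>Contractions in the maximum norm\<close>

lemma infnorm_le_cart:
  fixes x :: "real^'n"
  assumes "\<And>i. \<bar>x $ i\<bar> \<le> B"
  shows "infnorm x \<le> B"
  unfolding infnorm_cart by (rule cSup_least) (use assms in auto)

text \<open>
  A contraction in the maximum norm need not shrink Euclidean distances in one step, but the two
  norms are equivalent, so the conversion costs only the constant in front of \<open>q ^ k\<close>.
\<close>

lemma locally_exp_stable_if_infnorm_contraction:
  fixes F :: "real^'n \<Rightarrow> real^'n"
  assumes p: "p \<in> X"
    and maps: "\<And>x. x \<in> X \<Longrightarrow> F x \<in> X"
    and r: "0 < r"
    and q: "0 < q" "q < 1"
    and contr: "\<And>x. \<lbrakk>x \<in> X; infnorm (x - p) \<le> r\<rbrakk> \<Longrightarrow> infnorm (F x - p) \<le> q * infnorm (x - p)"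
  shows "locally_exp_stable_equilibrium F X p"
proof -
  have "infnorm (F p - p) \<le> q * infnorm (p - p)"
    using p r by (intro contr) (auto simp: infnorm_0)
  then have "F p = p"
    using infnorm_pos_le[of "F p - p"] infnorm_eq_0[of "F p - p"] by (simp add: infnorm_0)
  define C where "C = sqrt (DIM(real^'n))"
  have C: "0 < C"
    by (simp add: C_def)
  have decay: "(F ^^ k) x \<in> X \<and> infnorm ((F ^^ k) x - p) \<le> q ^ k * infnorm (x - p)"
    if x: "x \<in> X" "infnorm (x - p) \<le> r" for x k
  proof (induction k)
    case (Suc k)
    have "q ^ k * infnorm (x - p) \<le> 1 * infnorm (x - p)"
      using q infnorm_pos_le by (intro mult_right_mono) (auto simp: power_le_one)
    then have "infnorm ((F ^^ k) x - p) \<le> r"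
      using Suc x by linarith
    then have "infnorm (F ((F ^^ k) x) - p) \<le> q * infnorm ((F ^^ k) x - p)"
      using Suc by (intro contr) auto
    also have "\<dots> \<le> q * (q ^ k * infnorm (x - p))"
      using Suc q by (intro mult_left_mono) auto
    finally show ?case
      using Suc maps by (simp add: mult.assoc)
  qed (use x in simp)
  have "dist ((F ^^ k) x) p \<le> C * q ^ k * dist x p" if x: "x \<in> X" "dist x p < r" for x k
  proof -
    have le: "infnorm (x - p) \<le> dist x p"
      by (simp add: dist_norm infnorm_le_norm)
    have "dist ((F ^^ k) x) p \<le> C * infnorm ((F ^^ k) x - p)"
      unfolding dist_norm C_def by (rule norm_le_infnorm)
    also have "\<dots> \<le> C * (q ^ k * infnorm (x - p))"
      using decay[of x k] x le C by (intro mult_left_mono) auto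
    also have "\<dots> \<le> C * (q ^ k * dist x p)"
      using le C q by (intro mult_left_mono) auto
    finally show ?thesis
      by (simp add: mult.assoc)
  qed
  then show ?thesis
    unfolding locally_exp_stable_equilibrium_def equilibrium_def
    using p \<open>F p = p\<close> r q C by blast
qed

section \<open>The scalar update rule\<close>

definition biased_update :: "real \<Rightarrow> real \<Rightarrow> real \<Rightarrow> real \<Rightarrow> real \<Rightarrow> real" where
  "biased_update w \<beta> d x s =
     (w * x + x powr \<beta> * s) / (w + x powr \<beta> * s + (1 - x) powr \<beta> * (d - s))"

lemma opinion_map_component:
  "opinion_map G W b x $ i =
     biased_update (W $ i $ i) (b $ i) (nbr_weight G W i) (x $ i) (nbr_opinion G W x i)"
  by (simp add: opinion_map_def biased_update_def Let_def)

text \<open>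
  The nonzero denominator matters: with the convention \<open>0 / 0 = 0\<close> both updates would be 0.
\<close>

lemma biased_update_reflect:
  assumes "w + x powr \<beta> * s + (1 - x) powr \<beta> * (d - s) \<noteq> 0"
  shows "1 - biased_update w \<beta> d x s = biased_update w \<beta> d (1 - x) (d - s)"
proof -
  let ?D = "w + x powr \<beta> * s + (1 - x) powr \<beta> * (d - s)"
  have "1 - biased_update w \<beta> d x s = (?D - (w * x + x powr \<beta> * s)) / ?D"
    by (simp only: biased_update_def diff_divide_distrib divide_self[OF assms])
  also have "?D - (w * x + x powr \<beta> * s) = w * (1 - x) + (1 - x) powr \<beta> * (d - s)"
    by (simp add: right_diff_distrib)
  also have "\<dots> / ?D = biased_update w \<beta> d (1 - x) (d - s)"
    by (simp add: biased_update_def add.commute add.left_commute)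
  finally show ?thesis .
qed

text \<open>
  Opinions below \<open>r\<close> damp the neighbors' contribution to the numerator by \<open>r powr \<beta>\<close>; in the
  denominator the disagreement term alone contributes \<open>(1 - r) powr (\<beta> + 1) * d\<close>.
\<close>

definition contraction_factor :: "real \<Rightarrow> real \<Rightarrow> real \<Rightarrow> real \<Rightarrow> real" where
  "contraction_factor w \<beta> d r = (w + r powr \<beta> * d) / (w + (1 - r) powr (\<beta> + 1) * d)"

lemma biased_update_denominator_ge:
  fixes w \<beta> d r x s :: real
  assumes "0 \<le> d" "0 < \<beta>" "0 \<le> x" "x \<le> r" "r < 1" "0 \<le> s" "s \<le> r * d"
  shows "w + (1 - r) powr (\<beta> + 1) * d \<le> w + x powr \<beta> * s + (1 - x) powr \<beta> * (d - s)"
proof -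
  have "(1 - r) powr (\<beta> + 1) = (1 - r) powr \<beta> * (1 - r)"
    using \<open>r < 1\<close> powr_add[of "1 - r" \<beta> 1] by simp
  then have "(1 - r) powr (\<beta> + 1) * d = (1 - r) powr \<beta> * (d - r * d)"
    by (simp add: left_diff_distrib)
  also have "\<dots> \<le> (1 - x) powr \<beta> * (d - s)"
  proof (rule mult_mono)
    show "(1 - r) powr \<beta> \<le> (1 - x) powr \<beta>"
      using assms by (intro powr_mono2) auto
    have "r * d \<le> 1 * d"
      using assms by (intro mult_right_mono) auto
    then show "0 \<le> d - r * d"
      by simp
  qed (use assms in auto)
  moreover have "0 \<le> x powr \<beta> * s"
    using assms by simp
  ultimately show ?thesis
    by linarith
qed

lemma biased_update_contracts_near_0:
  assumes "0 \<le> w" "0 < d" "0 < \<beta>" "r < 1"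
    and x: "0 \<le> x" "x \<le> M" and s: "0 \<le> s" "s \<le> M * d" and M: "M \<le> r"
  shows "biased_update w \<beta> d x s \<le> contraction_factor w \<beta> d r * M"
proof -
  have "s \<le> r * d"
    using s M \<open>0 < d\<close> by (meson mult_right_mono less_imp_le order_trans)
  then have den: "w + (1 - r) powr (\<beta> + 1) * d \<le> w + x powr \<beta> * s + (1 - x) powr \<beta> * (d - s)"
    using assms by (intro biased_update_denominator_ge) auto
  have pos: "0 < w + (1 - r) powr (\<beta> + 1) * d"
    using assms by (intro add_nonneg_pos mult_pos_pos) auto
  have "x powr \<beta> * s \<le> r powr \<beta> * (M * d)"
    using assms by (intro mult_mono powr_mono2) auto
  moreover have "w * x \<le> w * M"
    using assms by (intro mult_left_mono) auto
  ultimately have num: "w * x + x powr \<beta> * s \<le> (w + r powr \<beta> * d) * M"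
    by (simp add: algebra_simps)
  have "biased_update w \<beta> d x s \<le> (w + r powr \<beta> * d) * M / (w + (1 - r) powr (\<beta> + 1) * d)"
    unfolding biased_update_def using num den pos assms by (intro frac_le) auto
  then show ?thesis
    by (simp add: contraction_factor_def)
qed

lemma eventually_contraction_factor_less_1:
  assumes "0 \<le> w" "0 < d" "0 < \<beta>"
  shows "\<forall>\<^sub>F r in at_right 0.
    0 < r \<and> r < 1 \<and> 0 < contraction_factor w \<beta> d r \<and> contraction_factor w \<beta> d r < 1"
proof -
  have "((\<lambda>r. (1 - r) powr (\<beta> + 1) - r powr \<beta>) \<longlongrightarrow> (1 - 0) powr (\<beta> + 1) - 0 powr \<beta>) (at_right 0)"
    using assms by (intro tendsto_intros) (auto simp: eventually_at_right_less less_imp_le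
        intro: eventually_mono[OF eventually_at_right_less])
  then have "\<forall>\<^sub>F r in at_right 0. 0 < (1 - r) powr (\<beta> + 1) - r powr \<beta>"
    by (rule order_tendstoD) simp
  moreover have "\<forall>\<^sub>F r in at_right 0. r \<in> {0<..<1::real}"
    by (rule eventually_at_right_real) simp
  ultimately show ?thesis
  proof eventually_elim
    case (elim r)
    then have "r powr \<beta> * d < (1 - r) powr (\<beta> + 1) * d" "0 < r powr \<beta> * d"
      using assms by (auto intro: mult_strict_right_mono)
    then show ?case
      using elim assms by (auto simp: contraction_factor_def add_nonneg_pos)
  qed
qed

text \<open>
  Subtracting the lower bound \<open>m\<close> from the new opinion leaves the numerator
  \<open>w * (x - m) + (1 - m) * x powr \<beta> * s - m * (1 - x) powr \<beta> * (d - s)\<close>, which is increasing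
  in \<open>s\<close>; at \<open>s = m * d\<close> it is at least \<open>m * (1 - m) * d\<close> times the excess of
  \<open>x powr \<beta>\<close> over \<open>(1 - x) powr \<beta>\<close>.  On \<open>[1/2, 3/4]\<close> the factor \<open>m * (1 - m)\<close> exceeds 1/8.
\<close>

lemma biased_update_gains_above_half:
  assumes w: "0 \<le> w" and d: "0 < d" and \<beta>: "0 < \<beta>"
    and m: "1/2 < m0" "m0 \<le> m" "m \<le> 3/4"
    and x: "m \<le> x" "x \<le> 1" and s: "m * d \<le> s" "s \<le> d"
  shows "m + d * (m0 powr \<beta> - (1 - m0) powr \<beta>) / (8 * (w + d)) \<le> biased_update w \<beta> d x s"
proof -
  define A where "A = x powr \<beta>"
  define B where "B = (1 - x) powr \<beta>"
  define D where "D = w + A * s + B * (d - s)"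
  define c where "c = m0 powr \<beta> - (1 - m0) powr \<beta>"
  have A: "0 < A" "A \<le> 1" and B: "0 \<le> B" "B \<le> 1"
    using x m \<beta> by (auto simp: A_def B_def powr_le1)
  have "m0 powr \<beta> \<le> A" "B \<le> (1 - m0) powr \<beta>"
    using x m \<beta> by (auto simp: A_def B_def intro!: powr_mono2)
  then have AB: "c \<le> A - B"
    by (simp add: c_def)
  have "(1 - m0) powr \<beta> < m0 powr \<beta>"
    using m \<beta> by (intro powr_less_mono2) auto
  then have c: "0 < c"
    by (simp add: c_def)
  have "0 < m * d"
    using m d by simp
  then have s0: "0 < s"
    using s by linarith
  have "0 < A * s" "0 \<le> B * (d - s)" "A * s \<le> s" "B * (d - s) \<le> d - s"
    using A B s s0 by (auto intro: mult_left_le_one_le)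
  then have D: "0 < D" "D \<le> w + d"
    using w by (auto simp: D_def)
  have "0 \<le> (m - 1/4) * (3/4 - m)"
    using m by (intro mult_nonneg_nonneg) auto
  moreover have "(m - 1/4) * (3/4 - m) = m * (1 - m) - 3/16"
    by (simp add: field_simps)
  ultimately have mm: "1/8 \<le> m * (1 - m)"
    by linarith
  have "c * d * (1/8) \<le> (A - B) * d * (m * (1 - m))"
    using AB c d mm by (intro mult_mono) auto
  also have "\<dots> = (1 - m) * A * (m * d) - m * B * (d - m * d)"
    by (simp add: algebra_simps)
  also have "\<dots> \<le> (1 - m) * A * s - m * B * (d - s)"
    using m A B s by (intro diff_mono mult_left_mono) auto
  also have "\<dots> \<le> w * (x - m) + \<dots>"
    using w x by simp
  also have "\<dots> = (w * x + A * s) - m * D"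
    by (simp add: D_def algebra_simps)
  finally have gain: "c * d / 8 \<le> (w * x + A * s) - m * D"
    by simp
  have "0 < c * d / 8"
    using c d by simp
  have "d * c / (8 * (w + d)) = (c * d / 8) / (w + d)"
    by simp
  also have "\<dots> \<le> ((w * x + A * s) - m * D) / D"
    using gain \<open>0 < c * d / 8\<close> D by (intro frac_le) linarith+
  also have "\<dots> = biased_update w \<beta> d x s - m"
    using D by (simp add: biased_update_def A_def B_def D_def diff_divide_distrib)
  finally show ?thesis
    by (simp add: c_def)
qed

section \<open>Networks in which every agent has a neighbor\<close>

locale opinion_network =
  fixes G :: "'n::finite pair_pre_digraph" and W :: "real^'n^'n" and b :: "real^'n"
  assumes diag: "\<And>i. W $ i $ i \<ge> 0"
    and arcs: "\<And>i j. (j, i) \<in> parcs G \<Longrightarrow> W $ i $ j > 0"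
    and has_neighbor: "\<And>i. \<exists>j. (j, i) \<in> parcs G"
    and bias: "\<And>i. b $ i > 0"
begin

abbreviation F :: "real^'n \<Rightarrow> real^'n" where
  "F \<equiv> opinion_map G W b"

abbreviation d :: "'n \<Rightarrow> real" where
  "d \<equiv> nbr_weight G W"

lemma d_pos: "0 < d i"
  unfolding nbr_weight_def neighbors_def using arcs has_neighbor by (intro sum_pos) auto

lemma nbr_opinion_ge:
  assumes "\<And>j. m \<le> x $ j"
  shows "m * d i \<le> nbr_opinion G W x i"
  unfolding nbr_weight_def nbr_opinion_def neighbors_def sum_distrib_left
  using arcs assms by (intro sum_mono) (auto simp: mult.commute less_imp_le intro!: mult_left_mono)

lemma nbr_opinion_le:
  assumes "\<And>j. x $ j \<le> M"
  shows "nbr_opinion G W x i \<le> M * d i"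
  unfolding nbr_weight_def nbr_opinion_def neighbors_def sum_distrib_left
  using arcs assms by (intro sum_mono) (auto simp: mult.commute less_imp_le intro!: mult_left_mono)

lemma nbr_opinion_reflect: "nbr_opinion G W (1 - x) i = d i - nbr_opinion G W x i"
  by (simp add: nbr_weight_def nbr_opinion_def right_diff_distrib sum_subtractf)

lemma maps_opinion_space: "x \<in> opinion_space \<Longrightarrow> F x \<in> opinion_space"
  using opinion_map_in_opinion_space[OF diag arcs] .

lemma reflect_in_opinion_space: "x \<in> opinion_space \<Longrightarrow> 1 - x \<in> opinion_space"
  unfolding mem_box_cart by simp

lemma uniform_contraction:
  obtains r q where "0 < r" "r < 1" "0 < q" "q < 1"
    and "\<And>i. contraction_factor (W $ i $ i) (b $ i) (d i) r \<le> q"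
proof -
  let ?c = "\<lambda>r i. contraction_factor (W $ i $ i) (b $ i) (d i) r"
  have "\<forall>\<^sub>F r in at_right 0. \<forall>i. 0 < r \<and> r < 1 \<and> 0 < ?c r i \<and> ?c r i < 1"
    by (intro eventually_all_finite eventually_contraction_factor_less_1 diag d_pos bias)
  then obtain r where r: "\<And>i. 0 < r \<and> r < 1 \<and> 0 < ?c r i \<and> ?c r i < 1"
    using eventually_happens'[OF trivial_limit_at_right_real] by blast
  have "Max (range (?c r)) \<in> range (?c r)"
    by (rule Max_in) auto
  then obtain i where i: "Max (range (?c r)) = ?c r i"
    by blast
  have "?c r j \<le> ?c r i" for j
    unfolding i[symmetric] by (rule Max_ge) auto
  then show thesis
    using r by (intro that[of r "?c r i"]) auto
qed

lemma contracts_near_0: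
  assumes r: "r < 1" and q: "\<And>i. contraction_factor (W $ i $ i) (b $ i) (d i) r \<le> q"
    and x: "x \<in> opinion_space" "infnorm x \<le> r"
  shows "infnorm (F x) \<le> q * infnorm x"
proof (rule infnorm_le_cart)
  fix i
  have x_bounds: "0 \<le> x $ j" "x $ j \<le> infnorm x" for j
    using x component_le_infnorm_cart[of x j] by (auto simp: mem_box_cart)
  have "F x $ i \<le> contraction_factor (W $ i $ i) (b $ i) (d i) r * infnorm x"
    unfolding opinion_map_component
    using r x x_bounds nbr_opinion_ge[of 0 x i] nbr_opinion_le[of x "infnorm x" i]
    by (intro biased_update_contracts_near_0 diag d_pos bias) auto
  also have "\<dots> \<le> q * infnorm x"
    by (intro mult_right_mono q infnorm_pos_le)
  finally show "\<bar>F x $ i\<bar> \<le> q * infnorm x"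
    using maps_opinion_space[OF x(1)] by (simp add: mem_box_cart)
qed

text \<open>
  The bound \<open>r < 1\<close> keeps all denominators positive.  At norm 1 an agent without self-weight may
  face neighbors that are unanimously at the opposite end, and then the quotient \<open>0 / 0\<close>
  breaks the symmetry.
\<close>

lemma reflect_near_0:
  assumes r: "r < 1" and x: "x \<in> opinion_space" "infnorm x \<le> r"
  shows "F (1 - x) = 1 - F x"
proof -
  have "F (1 - x) $ i = (1 - F x) $ i" for i
  proof -
    have x_bounds: "0 \<le> x $ j" "x $ j \<le> r" for j
      using x component_le_infnorm_cart[of x j] by (auto simp: mem_box_cart)
    let ?s = "nbr_opinion G W x i"
    have "0 < W $ i $ i + (1 - r) powr (b $ i + 1) * d i"
      using r diag d_pos by (intro add_nonneg_pos mult_pos_pos) auto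
    also have "\<dots> \<le> W $ i $ i + x $ i powr b $ i * ?s + (1 - x $ i) powr b $ i * (d i - ?s)"
      using r x_bounds nbr_opinion_ge[of 0 x i] nbr_opinion_le[of x r i] less_imp_le[OF d_pos]
      by (intro biased_update_denominator_ge bias) auto
    finally show ?thesis
      by (simp add: opinion_map_component nbr_opinion_reflect biased_update_reflect)
  qed
  then show ?thesis
    by (simp add: vec_eq_iff)
qed

theorem zero_locally_exp_stable: "locally_exp_stable_equilibrium F opinion_space (vec 0)"
proof -
  obtain r q where "0 < r" "r < 1" "0 < q" "q < 1"
    and "\<And>i. contraction_factor (W $ i $ i) (b $ i) (d i) r \<le> q"
    by (rule uniform_contraction) blast
  then show ?thesis
    using contracts_near_0 maps_opinion_space
    by (intro locally_exp_stable_if_infnorm_contraction[where r = r and q = q])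
      (auto simp: mem_box_cart)
qed

theorem one_locally_exp_stable: "locally_exp_stable_equilibrium F opinion_space (vec 1)"
proof -
  obtain r q where r: "0 < r" "r < 1" and q: "0 < q" "q < 1"
    and c: "\<And>i. contraction_factor (W $ i $ i) (b $ i) (d i) r \<le> q"
    by (rule uniform_contraction) blast
  have "infnorm (F x - vec 1) \<le> q * infnorm (x - vec 1)"
    if x: "x \<in> opinion_space" "infnorm (x - vec 1) \<le> r" for x
  proof -
    have y: "1 - x \<in> opinion_space" "infnorm (1 - x) \<le> r"
      using x reflect_in_opinion_space by (auto simp: infnorm_sub)
    have "F x = 1 - F (1 - x)"
      using reflect_near_0[OF r(2) y] by simp
    then show ?thesis
      using contracts_near_0[OF r(2) c y] by (simp add: infnorm_neg infnorm_sub[of x])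
  qed
  then show ?thesis
    using r q maps_opinion_space
    by (intro locally_exp_stable_if_infnorm_contraction[where r = r and q = q])
      (auto simp: mem_box_cart)
qed

lemma half_equilibrium: "equilibrium F opinion_space (vec (1/2))"
proof -
  have "F (vec (1/2)) $ i = 1/2" for i
  proof -
    have s: "nbr_opinion G W (vec (1/2)) i = d i / 2"
      by (simp add: nbr_weight_def nbr_opinion_def sum_divide_distrib)
    have "0 < W $ i $ i + (1/2) powr (b $ i) * d i"
      using diag d_pos by (intro add_nonneg_pos mult_pos_pos) auto
    then show ?thesis
      by (simp add: opinion_map_component biased_update_def s field_simps)
  qed
  then show ?thesis
    by (auto simp: equilibrium_def mem_box_cart vec_eq_iff)
qed

text \<open>
  Here \<open>m\<close> is any lower bound of the opinions, not their minimum, and \<open>c\<close> does not depend on it;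
  this is the form that can be iterated with \<open>m\<close> growing linearly in time.
\<close>

lemma uniform_gain:
  assumes "1/2 < m0" "m0 \<le> 1"
  obtains c where "0 < c"
    and "\<And>m x i. \<lbrakk>m0 \<le> m; m \<le> 3/4; x \<in> opinion_space; \<And>j. m \<le> x $ j\<rbrakk> \<Longrightarrow> m + c \<le> F x $ i"
proof -
  let ?c = "\<lambda>i. d i * (m0 powr b $ i - (1 - m0) powr b $ i) / (8 * (W $ i $ i + d i))"
  have pos: "0 < ?c i" for i
  proof -
    have "(1 - m0) powr b $ i < m0 powr b $ i"
      using assms bias by (intro powr_less_mono2) auto
    then show ?thesis
      using d_pos diag by (intro divide_pos_pos mult_pos_pos) (auto intro: add_nonneg_pos)
  qed
  have "m + Min (range ?c) \<le> F x $ i"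
    if x: "m0 \<le> m" "m \<le> 3/4" "x \<in> opinion_space" "\<And>j. m \<le> x $ j" for m x i
  proof -
    have "m + Min (range ?c) \<le> m + ?c i"
      by (intro add_left_mono Min_le) auto
    also have "\<dots> \<le> F x $ i"
      unfolding opinion_map_component
      using assms x nbr_opinion_ge[of m x i] nbr_opinion_le[of x 1 i]
      by (intro biased_update_gains_above_half diag d_pos bias) (auto simp: mem_box_cart)
    finally show ?thesis .
  qed
  moreover have "0 < Min (range ?c)"
    using pos by (subst Min_gr_iff) auto
  ultimately show thesis
    using that by blast
qed

theorem half_unstable: "unstable_equilibrium F opinion_space (vec (1/2))"
proof -
  have "\<not> lyapunov_stable F opinion_space (vec (1/2))"
  proof
    assume "lyapunov_stable F opinion_space (vec (1/2))"
    then obtain \<delta> where \<delta>: "0 < \<delta>"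
      and stable: "\<And>x k. \<lbrakk>x \<in> opinion_space; dist x (vec (1/2)) < \<delta>\<rbrakk>
        \<Longrightarrow> dist ((F ^^ k) x) (vec (1/2)) < 1/4"
      unfolding lyapunov_stable_def by (meson zero_less_divide_1_iff zero_less_numeral)
    \<comment> \<open>The Euclidean distance of the initial state to 1/2 is at most \<open>t\<close> times the number of
      agents; \<open>t \<le> 1/4\<close> starts the trajectory in the range where opinions gain.\<close>
    define t where "t = min (1/4) (\<delta> / (2 * CARD('n)))"
    have t: "0 < t" "t \<le> 1/4"
      using \<delta> by (auto simp: t_def)
    define x where "x = (vec (1/2 + t) :: real^'n)"
    have "dist x (vec (1/2)) \<le> (\<Sum>i\<in>(UNIV :: 'n set). \<bar>t\<bar>)"
      unfolding dist_norm by (rule order_trans[OF norm_le_l1_cart]) (simp add: x_def)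
    also have "\<dots> \<le> CARD('n) * (\<delta> / (2 * CARD('n)))"
      unfolding sum_constant using t by (intro mult_left_mono) (auto simp: t_def)
    also have "\<dots> < \<delta>"
      using \<delta> by simp
    finally have close: "dist x (vec (1/2)) < \<delta>" .
    have x: "x \<in> opinion_space"
      using t by (simp add: x_def mem_box_cart)
    have traj: "(F ^^ k) x \<in> opinion_space" for k
      by (induction k) (use x maps_opinion_space in auto)
    have below: "(F ^^ k) x $ i < 3/4" for k i
    proof -
      have "\<bar>(F ^^ k) x $ i - 1/2\<bar> < 1/4"
        using stable[OF x close, of k] component_le_norm_cart[of "(F ^^ k) x - vec (1/2)" i]
        by (simp add: dist_norm)
      then show ?thesis
        by linarith
    qed
    obtain c where c: "0 < c" and gain: "\<And>m x i. \<lbrakk>1/2 + t \<le> m; m \<le> 3/4; x \<in> opinion_space;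
        \<And>j. m \<le> x $ j\<rbrakk> \<Longrightarrow> m + c \<le> F x $ i"
      by (rule uniform_gain[of "1/2 + t"]) (use t in auto)
    have growth: "1/2 + t + real k * c \<le> (F ^^ k) x $ i" for k i
    proof (induction k arbitrary: i)
      case (Suc k)
      have "1/2 + t + real k * c \<le> 3/4"
        using Suc below[of k undefined] by (meson less_imp_le order_trans)
      then have "1/2 + t + real k * c + c \<le> F ((F ^^ k) x) $ i"
        using c Suc by (intro gain traj) auto
      then show ?case
        by (simp add: algebra_simps)
    qed (simp add: x_def)
    obtain k where "1 < real k * c"
      using reals_Archimedean3[OF c] by blast
    then show False
      \<comment> \<open>any agent will do\<close>
      using growth[of k undefined] below[of k undefined] t by linarith
  qed
  then show ?thesis
    using half_equilibrium by (simp add: unstable_equilibrium_def)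
qed

end

section \<open>Strongly connected networks\<close>

lemma strongly_connected_in_neighbor:
  fixes G :: "'a pair_pre_digraph"
  assumes "strongly_connected (with_proj G)" and "u \<in> pverts G" "i \<in> pverts G" "u \<noteq> i"
  obtains j where "(j, i) \<in> parcs G"
proof -
  have "(u, i) \<in> rtrancl_on (pverts G) (parcs G)"
    using assms by (auto simp: strongly_connected_def reachable_def)
  then show thesis
    using \<open>u \<noteq> i\<close> that by cases auto
qed

theorem theorem1:
  fixes G :: "'n::finite pair_pre_digraph"
    and W :: "real^'n^'n"
    and b :: "real^'n"
  assumes "CARD('n) \<ge> 2"
    and "pair_digraph G"
    and "pverts G = UNIV"
    and "\<And>i. W $ i $ i \<ge> 0"
    and "\<And>i j. (j, i) \<in> parcs G \<Longrightarrow> W $ i $ j > 0"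
    and "strongly_connected (with_proj G)"
    and "\<And>i. b $ i > 0"
  shows "locally_exp_stable_equilibrium (opinion_map G W b) opinion_space (vec 0) \<and>
         locally_exp_stable_equilibrium (opinion_map G W b) opinion_space (vec 1) \<and>
         unstable_equilibrium (opinion_map G W b) opinion_space (vec (1 / 2))"
proof -
  have "\<exists>j. (j, i) \<in> parcs G" for i
  proof -
    have "(UNIV :: 'n set) \<noteq> {i}"
    proof
      assume "(UNIV :: 'n set) = {i}"
      then have "CARD('n) = 1"
        by (metis card_1_singleton_iff One_nat_def)
      then show False
        using assms(1) by simp
    qed
    then obtain u where "u \<noteq> i"
      by blast
    then show ?thesis
      using strongly_connected_in_neighbor[OF assms(6), of u i] assms(3) by blast
  qed
  then interpret opinion_network G W b
    using assms by unfold_locales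
  show ?thesis
    using zero_locally_exp_stable one_locally_exp_stable half_unstable by blast
qed

end
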